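(* Consider a multi-stage stochastic dynamic team $(\mathcal{P}^{\text{Multi}})$ with $N$ agents over the time horizon $\mathcal{T}=\{0,\dots,T-1\}$. (i) If there exists an independent-data static reduction, then $\underline{\pmb\gamma}^*$ is an agent-wise (AG-wise) (respectively, DM-wise) pbp optimal policy for $(\mathcal{P}^{\text{Multi}})$ if and only if it is an AG-wise (respectively, DM-wise) pbp optimal policy under the independent-data static reduction. (ii) If there exists an AG-wise (partially) nested independent reduction, then $\underline{\pmb\gamma}^*$ is an AG-wise pbp optimal policy for $(\mathcal{P}^{\text{Multi}})$ if and only if it is an AG-wise pbp optimal policy under the AG-wise (partially) nested independent reduction.
   Context: Problem $(\mathcal{P}^{\text{Multi}})$. $\mathcal{N}=\{1,\dots,N\}$. For $t\in\mathcal{T}$, states and observations are $x_{t+1}=f_t(x_{0:t},u^{1:N}_{0:t},w_t)$ and $y^i_t=h^i_t(x_{0:t},u^{1:N}_{0:t-1},v^i_t)$, $i\in\mathcal{N}$, with $f_t,h^i_t$ measurable, where $x_{0:t}=(x_0,\dots,x_t)$, $u^{1:N}_{0:t}=(u^k_s)_{s\le t,\,k\le N}$, and the disturbances $w_t,v^1_t,\dots,v^N_t$ are random variables; all state, action, observation and disturbance spaces are standard Borel. Agent AG$^i$ is the collection of decision makers DM$^i_0,\dots,$DM$^i_{T-1}$. Given information $I^i_t\subseteq\{y^{1:N}_{0:t},u^{1:N}_{0:t-1}\}$, an admissible policy $\gamma^i_t\in\Gamma^i_t$ is measurable with $u^i_t=\gamma^i_t(I^i_t)$; $\pmb\gamma^i=(\gamma^i_0,\dots,\gamma^i_{T-1})\in\mathbf{\Gamma}^i=\prod_t\Gamma^i_t$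 and $\underline{\pmb\gamma}=(\pmb\gamma^1,\dots,\pmb\gamma^N)$. The expected cost is $J(\underline{\pmb\gamma})=E^{\underline{\pmb\gamma}}\big[\sum_{t=0}^{T-1}c_t(\omega_0,x_t,u^1_t,\dots,u^N_t)+c_T(x_T)\big]$ with Borel nonnegative costs and an exogenous random variable $\omega_0$ with law $\mathbb{P}^0$. For $z=u,y,w,v$, write $\pmb z^i=(z^i_0,\dots,z^i_{T-1})$ and $\underline{\pmb z}=(\pmb z^1,\dots,\pmb z^N)$. $\tilde{\mathbb{P}}$ is the joint law of $(\omega_0,x_0,\underline{\pmb w},\underline{\pmb v},\underline{\pmb u},\underline{\pmb y})$, and $\mu$ is the fixed law of $(\omega_0,x_0,\underline{\pmb w},\underline{\pmb v})$. Optimality. $\underline{\pmb\gamma}^*$ is AG-wise pbp optimal if $J(\underline{\pmb\gamma}^* )\le J(\pmb\gamma^{-i*},\pmb\beta)$ for all $i$ and all $\pmb\beta\in\mathbf{\Gamma}^i$ (policies of all other agents fixed). It is DM-wise pbp optimal if for all $i\in\mathcal{N}$, $t\in\mathcal{T}$ and $\beta^i_t\in\Gamma^i_t$, $J(\underline{\pmb\gamma}^* )\le J(\pmb\gamma^{-i*},(\gamma^{i*}_{-t},\beta^i_t))$, where $(\gamma^{i*}_{-t},\beta^i_t)$ is $\pmb\gamma^{i*}$ with its $t$-component replaced by $\beta^i_t$. Under a reduction the same definitions apply with $J$ expressed as the expected cost of the reduced problem. Independent-data static reduction. It exists if for every $i\in\mathcal{N}$, $t\in\mathcal{T}$ there are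 a probability measure $\tilde Q^i_t$ on $\mathbb{Y}^i_t$ and a measurable $\phi^i_t$ such that for all Borel $A=A^1\times\dots\times A^N$, $$P\big((y^1_t,\dots,y^N_t)\in A\mid\omega_0,x_0,v^{1:N}_{0:t-1},w^{1:N}_{0:t-1},y^{1:N}_{0:t-1},u^{1:N}_{0:t-1}\big)=\prod_{i=1}^N\int_{A^i}\phi^i_t(y^i_t,\omega_0,x_0,v^{1:N}_{0:t-1},w^{1:N}_{0:t-1},y^{1:N}_{0:t-1},u^{1:N}_{0:t-1})\,\tilde Q^i_t(dy^i_t).$$ Then $\tilde{\mathbb{P}}\ll\tilde{\mathbb{Q}}$ with $\tilde{\mathbb{Q}}=\mu(d\omega_0,dx_0,d\underline{\pmb w},d\underline{\pmb v})\prod_{t}\prod_{i}\tilde Q^i_t(dy^i_t)\,1_{\{\gamma^i_t(I^i_t)\in du^i_t\}}$ and $\frac{d\tilde{\mathbb{P}}}{d\tilde{\mathbb{Q}}}=\prod_t\prod_i\phi^i_t$; in the reduced problem the measurements $y^i_t$ are independent with laws $\tilde Q^i_t$, and the expected cost is $E^{\underline{\pmb\gamma}}_{\tilde{\mathbb{Q}}}[\hat c]$ with $\hat c=\big(\sum_{t=0}^{T-1}c_t(\omega_0,x_t,u^1_t,\dots,u^N_t)+c_T(x_T)\big)\frac{d\tilde{\mathbb{P}}}{d\tilde{\mathbb{Q}}}$. AG-wise (partially) nested independent reduction. It is a reduction in which for every $i$ there is a probability measure $\hat Q^i$ such that for every Borel $B$, $\tilde{\mathbb{P}}(B)=\int_B\frac{d\tilde{\mathbb{P}}}{d\hat{\mathbb{Q}}}\,\hat{\mathbb{Q}}(d\underline{\pmb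 u},d\underline{\pmb y},d\underline{\pmb w},d\omega_0)$ with $\hat{\mathbb{Q}}=\prod_{i=1}^N\hat Q^i(d\pmb u^i,d\pmb y^i,d\pmb w^i)\,\mathbb{P}^0(d\omega_0)$, where the measures may depend on the policies but the change of measure (the density) is policy-independent; under it, for each agent AG$^i$ the information is nested through time, i.e. $\sigma(y^i_t)\subset\sigma(y^i_{t+1})$ (partially nested through time, in the "partially nested" version), and the expected cost is $J(\underline{\pmb\gamma})=E^{\underline{\pmb\gamma}}_{\hat{\mathbb{Q}}}\big[c(\omega_0,\underline{\pmb u},\underline{\pmb y},\underline{\pmb w})\frac{d\tilde{\mathbb{P}}}{d\hat{\mathbb{Q}}}\big]$, with $c(\omega_0,\underline{\pmb u},\underline{\pmb y},\underline{\pmb w})$ the total cost.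
   Formalization: In (i), the change of measure from P̃ to Q̃ with density the product of the φ's (as an identity of the laws of ω0, x0, w, u, y under every admissible policy) is required as part of the independent-data static reduction, since the conditional-law display alone does not imply it. *)

theory Defs
  imports "HOL-Probability.Probability"
begin

text \<open>The Borel sigma-algebra of a Polish topology.\<close>

definition standard_borel :: "'a measure \<Rightarrow> bool" where
  "standard_borel M \<longleftrightarrow>
     (\<exists>S. topspace S = space M \<and> completely_metrizable_space S \<and> second_countable S \<and>
          sets M = sigma_sets (space M) {B. openin S B})"

text \<open>
  All spaces of one kind live on one type, but the measurable space may vary with agent and time;
  only the measurable structure of the \<open>_space\<close> fields matters. Agents are \<open>1, \<dots>, N\<close>,
  decision times are \<open>0, \<dots>, T - 1\<close> and states are indexed by \<open>0, \<dots>, T\<close>.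
  Families indexed by agent and time take the agent first.

  The disturbance entering the state equation at time \<open>t\<close> is the tuple
  \<open>(w i t)\<close> over the agents \<open>i\<close>; a disturbance without agent structure is one with all but one
  component trivial.

  The information \<open>I i t\<close> is the subfamily of \<open>(y j s)\<close>, \<open>s \<le> t\<close>, and \<open>(u j s)\<close>, \<open>s < t\<close>, selected by
  the sets of pairs \<open>(j, s)\<close> in \<open>obs_info i t\<close> and \<open>act_info i t\<close>.
\<close>

record ('a, 'o, 'x, 'u, 'y, 'w, 'v) team =
  num_agents :: nat
  horizon :: nat
  sample :: "'a measure"
  exo_space :: "'o measure"
  state_space :: "nat \<Rightarrow> 'x measure"
  act_space :: "nat \<Rightarrow> nat \<Rightarrow> 'u measure"
  obs_space :: "nat \<Rightarrow> nat \<Rightarrow> 'y measure"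
  dist_space :: "nat \<Rightarrow> nat \<Rightarrow> 'w measure"
  noise_space :: "nat \<Rightarrow> nat \<Rightarrow> 'v measure"
  exo :: "'a \<Rightarrow> 'o"
  init :: "'a \<Rightarrow> 'x"
  dist_rv :: "nat \<Rightarrow> nat \<Rightarrow> 'a \<Rightarrow> 'w"
  noise_rv :: "nat \<Rightarrow> nat \<Rightarrow> 'a \<Rightarrow> 'v"
  dyn :: "nat \<Rightarrow> (nat \<Rightarrow> 'x) \<times> (nat \<Rightarrow> nat \<Rightarrow> 'u) \<times> (nat \<Rightarrow> 'w) \<Rightarrow> 'x"
  obs_map :: "nat \<Rightarrow> nat \<Rightarrow> (nat \<Rightarrow> 'x) \<times> (nat \<Rightarrow> nat \<Rightarrow> 'u) \<times> 'v \<Rightarrow> 'y"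
  stage_cost :: "nat \<Rightarrow> 'o \<times> 'x \<times> (nat \<Rightarrow> 'u) \<Rightarrow> real"
  final_cost :: "'x \<Rightarrow> real"
  obs_info :: "nat \<Rightarrow> nat \<Rightarrow> (nat \<times> nat) set"
  act_info :: "nat \<Rightarrow> nat \<Rightarrow> (nat \<times> nat) set"

type_synonym ('y, 'u) team_policy =
  "nat \<Rightarrow> nat \<Rightarrow> (nat \<times> nat \<Rightarrow> 'y) \<times> (nat \<times> nat \<Rightarrow> 'u) \<Rightarrow> 'u"

text \<open>\<open>z\<close> for all agents and the times \<open>0, \<dots>, n - 1\<close>.\<close>

definition hist :: "('a, 'o, 'x, 'u, 'y, 'w, 'v) team \<Rightarrow> nat \<Rightarrow> (nat \<Rightarrow> nat \<Rightarrow> 'z) \<Rightarrow> nat \<Rightarrow> nat \<Rightarrow> 'z" where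
  "hist P n z = (\<lambda>i\<in>{1..num_agents P}. \<lambda>s\<in>{..<n}. z i s)"

definition hist_space ::
  "('a, 'o, 'x, 'u, 'y, 'w, 'v) team \<Rightarrow> (nat \<Rightarrow> nat \<Rightarrow> 'z measure) \<Rightarrow> nat \<Rightarrow> (nat \<Rightarrow> nat \<Rightarrow> 'z) measure" where
  "hist_space P Z n = (\<Pi>\<^sub>M i\<in>{1..num_agents P}. \<Pi>\<^sub>M s\<in>{..<n}. Z i s)"

locale dynamic_team = prob_space "sample P"
  for P :: "('a, 'o, 'x, 'u, 'y, 'w, 'v) team" +
  assumes num_agents_pos: "num_agents P \<ge> 1"
    and horizon_pos: "horizon P \<ge> 1"
    and standard_borel_state: "t \<le> horizon P \<Longrightarrow> standard_borel (state_space P t)"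
    and standard_borel_act:
      "i \<in> {1..num_agents P} \<Longrightarrow> t < horizon P \<Longrightarrow> standard_borel (act_space P i t)"
    and standard_borel_obs:
      "i \<in> {1..num_agents P} \<Longrightarrow> t < horizon P \<Longrightarrow> standard_borel (obs_space P i t)"
    and standard_borel_dist:
      "i \<in> {1..num_agents P} \<Longrightarrow> t < horizon P \<Longrightarrow> standard_borel (dist_space P i t)"
    and standard_borel_noise:
      "i \<in> {1..num_agents P} \<Longrightarrow> t < horizon P \<Longrightarrow> standard_borel (noise_space P i t)"
    and exo_meas: "exo P \<in> sample P \<rightarrow>\<^sub>M exo_space P"
    and init_meas: "init P \<in> sample P \<rightarrow>\<^sub>M state_space P 0"
    and dist_meas:
      "i \<in> {1..num_agents P} \<Longrightarrow> t < horizon P \<Longrightarrow> dist_rv P i t \<in> sample P \<rightarrow>\<^sub>M dist_space P i t"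
    and noise_meas:
      "i \<in> {1..num_agents P} \<Longrightarrow> t < horizon P \<Longrightarrow> noise_rv P i t \<in> sample P \<rightarrow>\<^sub>M noise_space P i t"
    and dyn_meas:
      "t < horizon P \<Longrightarrow>
         dyn P t \<in> (\<Pi>\<^sub>M s\<in>{..t}. state_space P s) \<Otimes>\<^sub>M hist_space P (act_space P) (Suc t)
                    \<Otimes>\<^sub>M (\<Pi>\<^sub>M i\<in>{1..num_agents P}. dist_space P i t) \<rightarrow>\<^sub>M state_space P (Suc t)"
    and obs_map_meas:
      "i \<in> {1..num_agents P} \<Longrightarrow> t < horizon P \<Longrightarrow>
         obs_map P i t \<in> (\<Pi>\<^sub>M s\<in>{..t}. state_space P s) \<Otimes>\<^sub>M hist_space P (act_space P) t
                    \<Otimes>\<^sub>M noise_space P i t \<rightarrow>\<^sub>M obs_space P i t"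
    and stage_cost_meas:
      "t < horizon P \<Longrightarrow>
         stage_cost P t \<in> borel_measurable
           (exo_space P \<Otimes>\<^sub>M state_space P t \<Otimes>\<^sub>M (\<Pi>\<^sub>M i\<in>{1..num_agents P}. act_space P i t))"
    and stage_cost_nonneg:
      "t < horizon P \<Longrightarrow>
         z \<in> space (exo_space P \<Otimes>\<^sub>M state_space P t \<Otimes>\<^sub>M (\<Pi>\<^sub>M i\<in>{1..num_agents P}. act_space P i t)) \<Longrightarrow>
         stage_cost P t z \<ge> 0"
    and final_cost_meas: "final_cost P \<in> borel_measurable (state_space P (horizon P))"
    and final_cost_nonneg: "x \<in> space (state_space P (horizon P)) \<Longrightarrow> final_cost P x \<ge> 0"
    and obs_info_sub:
      "i \<in> {1..num_agents P} \<Longrightarrow> t < horizon P \<Longrightarrow> obs_info P i t \<subseteq> {1..num_agents P} \<times> {..t}"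
    and act_info_sub:
      "i \<in> {1..num_agents P} \<Longrightarrow> t < horizon P \<Longrightarrow> act_info P i t \<subseteq> {1..num_agents P} \<times> {..<t}"

section \<open>Policies and closed-loop trajectories\<close>

definition info_space ::
  "('a, 'o, 'x, 'u, 'y, 'w, 'v) team \<Rightarrow> nat \<Rightarrow> nat \<Rightarrow> ((nat \<times> nat \<Rightarrow> 'y) \<times> (nat \<times> nat \<Rightarrow> 'u)) measure" where
  "info_space P i t =
     (\<Pi>\<^sub>M k\<in>obs_info P i t. obs_space P (fst k) (snd k)) \<Otimes>\<^sub>M
     (\<Pi>\<^sub>M k\<in>act_info P i t. act_space P (fst k) (snd k))"

definition info ::
  "('a, 'o, 'x, 'u, 'y, 'w, 'v) team \<Rightarrow> nat \<Rightarrow> nat \<Rightarrow> (nat \<Rightarrow> nat \<Rightarrow> 'y) \<Rightarrow> (nat \<Rightarrow> nat \<Rightarrow> 'u)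
     \<Rightarrow> (nat \<times> nat \<Rightarrow> 'y) \<times> (nat \<times> nat \<Rightarrow> 'u)" where
  "info P i t y u =
     (\<lambda>k\<in>obs_info P i t. y (fst k) (snd k), \<lambda>k\<in>act_info P i t. u (fst k) (snd k))"

definition dm_policies ::
  "('a, 'o, 'x, 'u, 'y, 'w, 'v) team \<Rightarrow> nat \<Rightarrow> nat
     \<Rightarrow> ((nat \<times> nat \<Rightarrow> 'y) \<times> (nat \<times> nat \<Rightarrow> 'u) \<Rightarrow> 'u) set" where
  "dm_policies P i t = info_space P i t \<rightarrow>\<^sub>M act_space P i t"

definition agent_policies ::
  "('a, 'o, 'x, 'u, 'y, 'w, 'v) team \<Rightarrow> nat
     \<Rightarrow> (nat \<Rightarrow> (nat \<times> nat \<Rightarrow> 'y) \<times> (nat \<times> nat \<Rightarrow> 'u) \<Rightarrow> 'u) set" where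
  "agent_policies P i = {\<beta>. \<forall>t<horizon P. \<beta> t \<in> dm_policies P i t}"

definition policies :: "('a, 'o, 'x, 'u, 'y, 'w, 'v) team \<Rightarrow> ('y, 'u) team_policy set" where
  "policies P = {\<gamma>. \<forall>i\<in>{1..num_agents P}. \<gamma> i \<in> agent_policies P i}"

text \<open>\<open>states P x0 w u t\<close> is the state history at the times \<open>0, \<dots>, t\<close>.\<close>

primrec states ::
  "('a, 'o, 'x, 'u, 'y, 'w, 'v) team \<Rightarrow> 'x \<Rightarrow> (nat \<Rightarrow> nat \<Rightarrow> 'w) \<Rightarrow> (nat \<Rightarrow> nat \<Rightarrow> 'u) \<Rightarrow> nat \<Rightarrow> nat \<Rightarrow> 'x" where
  "states P x0 w u 0 = (\<lambda>s\<in>{..0}. x0)"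
| "states P x0 w u (Suc t) = (states P x0 w u t)
     (Suc t := dyn P t (states P x0 w u t, hist P (Suc t) u, \<lambda>i\<in>{1..num_agents P}. w i t))"

definition observations ::
  "('a, 'o, 'x, 'u, 'y, 'w, 'v) team \<Rightarrow> 'x \<Rightarrow> (nat \<Rightarrow> nat \<Rightarrow> 'w) \<Rightarrow> (nat \<Rightarrow> nat \<Rightarrow> 'v) \<Rightarrow> (nat \<Rightarrow> nat \<Rightarrow> 'u)
     \<Rightarrow> nat \<Rightarrow> nat \<Rightarrow> 'y" where
  "observations P x0 w v u i t = obs_map P i t (states P x0 w u t, hist P t u, v i t)"

text \<open>
  The actions at the times \<open>0, \<dots>, n - 1\<close> generated by the policy \<open>\<gamma>\<close> when the actions \<open>u\<close> lead to the
  observations \<open>G u\<close>. The function \<open>G\<close> is given by the observation equation in the original problem,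
  and is constant in a problem whose measurements are not influenced by actions.
\<close>

primrec closed_loop ::
  "('a, 'o, 'x, 'u, 'y, 'w, 'v) team \<Rightarrow> ('y, 'u) team_policy \<Rightarrow> ((nat \<Rightarrow> nat \<Rightarrow> 'u) \<Rightarrow> nat \<Rightarrow> nat \<Rightarrow> 'y)
     \<Rightarrow> nat \<Rightarrow> nat \<Rightarrow> nat \<Rightarrow> 'u" where
  "closed_loop P \<gamma> G 0 = (\<lambda>i s. undefined)"
| "closed_loop P \<gamma> G (Suc t) = (\<lambda>i. (closed_loop P \<gamma> G t i)
     (t := \<gamma> i t (info P i t (G (closed_loop P \<gamma> G t)) (closed_loop P \<gamma> G t))))"

definition W_path :: "('a, 'o, 'x, 'u, 'y, 'w, 'v) team \<Rightarrow> 'a \<Rightarrow> nat \<Rightarrow> nat \<Rightarrow> 'w" where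
  "W_path P \<omega> = hist P (horizon P) (\<lambda>i t. dist_rv P i t \<omega>)"

definition V_path :: "('a, 'o, 'x, 'u, 'y, 'w, 'v) team \<Rightarrow> 'a \<Rightarrow> nat \<Rightarrow> nat \<Rightarrow> 'v" where
  "V_path P \<omega> = hist P (horizon P) (\<lambda>i t. noise_rv P i t \<omega>)"

definition U_path ::
  "('a, 'o, 'x, 'u, 'y, 'w, 'v) team \<Rightarrow> ('y, 'u) team_policy \<Rightarrow> 'a \<Rightarrow> nat \<Rightarrow> nat \<Rightarrow> 'u" where
  "U_path P \<gamma> \<omega> = hist P (horizon P)
     (closed_loop P \<gamma> (observations P (init P \<omega>) (W_path P \<omega>) (V_path P \<omega>)) (horizon P))"

definition Y_path ::
  "('a, 'o, 'x, 'u, 'y, 'w, 'v) team \<Rightarrow> ('y, 'u) team_policy \<Rightarrow> 'a \<Rightarrow> nat \<Rightarrow> nat \<Rightarrow> 'y" where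
  "Y_path P \<gamma> \<omega> = hist P (horizon P)
     (observations P (init P \<omega>) (W_path P \<omega>) (V_path P \<omega>) (U_path P \<gamma> \<omega>))"

section \<open>Expected cost and person-by-person optimality\<close>

definition total_cost ::
  "('a, 'o, 'x, 'u, 'y, 'w, 'v) team \<Rightarrow> 'o \<Rightarrow> 'x \<Rightarrow> (nat \<Rightarrow> nat \<Rightarrow> 'w) \<Rightarrow> (nat \<Rightarrow> nat \<Rightarrow> 'u) \<Rightarrow> ennreal" where
  "total_cost P o0 x0 w u = ennreal
     ((\<Sum>t<horizon P. stage_cost P t (o0, states P x0 w u t t, \<lambda>i\<in>{1..num_agents P}. u i t))
      + final_cost P (states P x0 w u (horizon P) (horizon P)))"

definition expected_cost :: "('a, 'o, 'x, 'u, 'y, 'w, 'v) team \<Rightarrow> ('y, 'u) team_policy \<Rightarrow> ennreal" where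
  "expected_cost P \<gamma> = (\<integral>\<^sup>+\<omega>. total_cost P (exo P \<omega>) (init P \<omega>) (W_path P \<omega>) (U_path P \<gamma> \<omega>) \<partial>sample P)"

definition agent_pbp_optimal ::
  "('a, 'o, 'x, 'u, 'y, 'w, 'v) team \<Rightarrow> (('y, 'u) team_policy \<Rightarrow> ennreal) \<Rightarrow> ('y, 'u) team_policy \<Rightarrow> bool" where
  "agent_pbp_optimal P K \<gamma> \<longleftrightarrow>
     \<gamma> \<in> policies P \<and>
     (\<forall>i\<in>{1..num_agents P}. \<forall>\<beta>\<in>agent_policies P i. K \<gamma> \<le> K (\<gamma>(i := \<beta>)))"

definition dm_pbp_optimal ::
  "('a, 'o, 'x, 'u, 'y, 'w, 'v) team \<Rightarrow> (('y, 'u) team_policy \<Rightarrow> ennreal) \<Rightarrow> ('y, 'u) team_policy \<Rightarrow> bool" where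
  "dm_pbp_optimal P K \<gamma> \<longleftrightarrow>
     \<gamma> \<in> policies P \<and>
     (\<forall>i\<in>{1..num_agents P}. \<forall>t<horizon P. \<forall>\<beta>\<in>dm_policies P i t.
        K \<gamma> \<le> K (\<gamma>(i := (\<gamma> i)(t := \<beta>))))"

section \<open>Independent-data static reduction\<close>

definition past_space ::
  "('a, 'o, 'x, 'u, 'y, 'w, 'v) team \<Rightarrow> nat
     \<Rightarrow> ('o \<times> 'x \<times> (nat \<Rightarrow> nat \<Rightarrow> 'v) \<times> (nat \<Rightarrow> nat \<Rightarrow> 'w) \<times> (nat \<Rightarrow> nat \<Rightarrow> 'y) \<times> (nat \<Rightarrow> nat \<Rightarrow> 'u)) measure" where
  "past_space P t = exo_space P \<Otimes>\<^sub>M state_space P 0 \<Otimes>\<^sub>M hist_space P (noise_space P) t \<Otimes>\<^sub>M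
     hist_space P (dist_space P) t \<Otimes>\<^sub>M hist_space P (obs_space P) t \<Otimes>\<^sub>M hist_space P (act_space P) t"

definition past ::
  "('a, 'o, 'x, 'u, 'y, 'w, 'v) team \<Rightarrow> ('y, 'u) team_policy \<Rightarrow> nat \<Rightarrow> 'a
     \<Rightarrow> 'o \<times> 'x \<times> (nat \<Rightarrow> nat \<Rightarrow> 'v) \<times> (nat \<Rightarrow> nat \<Rightarrow> 'w) \<times> (nat \<Rightarrow> nat \<Rightarrow> 'y) \<times> (nat \<Rightarrow> nat \<Rightarrow> 'u)" where
  "past P \<gamma> t \<omega> = (exo P \<omega>, init P \<omega>, hist P t (V_path P \<omega>), hist P t (W_path P \<omega>),
     hist P t (Y_path P \<gamma> \<omega>), hist P t (U_path P \<gamma> \<omega>))"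

definition joint_space ::
  "('a, 'o, 'x, 'u, 'y, 'w, 'v) team
     \<Rightarrow> ('o \<times> 'x \<times> (nat \<Rightarrow> nat \<Rightarrow> 'w) \<times> (nat \<Rightarrow> nat \<Rightarrow> 'v) \<times> (nat \<Rightarrow> nat \<Rightarrow> 'u) \<times> (nat \<Rightarrow> nat \<Rightarrow> 'y)) measure" where
  "joint_space P = exo_space P \<Otimes>\<^sub>M state_space P 0 \<Otimes>\<^sub>M
     hist_space P (dist_space P) (horizon P) \<Otimes>\<^sub>M hist_space P (noise_space P) (horizon P) \<Otimes>\<^sub>M
     hist_space P (act_space P) (horizon P) \<Otimes>\<^sub>M hist_space P (obs_space P) (horizon P)"

definition joint_law ::
  "('a, 'o, 'x, 'u, 'y, 'w, 'v) team \<Rightarrow> ('y, 'u) team_policy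
     \<Rightarrow> ('o \<times> 'x \<times> (nat \<Rightarrow> nat \<Rightarrow> 'w) \<times> (nat \<Rightarrow> nat \<Rightarrow> 'v) \<times> (nat \<Rightarrow> nat \<Rightarrow> 'u) \<times> (nat \<Rightarrow> nat \<Rightarrow> 'y)) measure" where
  "joint_law P \<gamma> = distr (sample P) (joint_space P)
     (\<lambda>\<omega>. (exo P \<omega>, init P \<omega>, W_path P \<omega>, V_path P \<omega>, U_path P \<gamma> \<omega>, Y_path P \<gamma> \<omega>))"

definition primitive_law ::
  "('a, 'o, 'x, 'u, 'y, 'w, 'v) team
     \<Rightarrow> ('o \<times> 'x \<times> (nat \<Rightarrow> nat \<Rightarrow> 'w) \<times> (nat \<Rightarrow> nat \<Rightarrow> 'v)) measure" where
  "primitive_law P = distr (sample P)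
     (exo_space P \<Otimes>\<^sub>M state_space P 0 \<Otimes>\<^sub>M hist_space P (dist_space P) (horizon P) \<Otimes>\<^sub>M
      hist_space P (noise_space P) (horizon P))
     (\<lambda>\<omega>. (exo P \<omega>, init P \<omega>, W_path P \<omega>, V_path P \<omega>))"

text \<open>
  The reference measure: primitive random variables with their original joint law, measurements
  independent of them and of each other with laws \<open>Q i t\<close>, and the actions determined by the
  measurements through the policy.
\<close>

definition static_law ::
  "('a, 'o, 'x, 'u, 'y, 'w, 'v) team \<Rightarrow> (nat \<Rightarrow> nat \<Rightarrow> 'y measure) \<Rightarrow> ('y, 'u) team_policy
     \<Rightarrow> ('o \<times> 'x \<times> (nat \<Rightarrow> nat \<Rightarrow> 'w) \<times> (nat \<Rightarrow> nat \<Rightarrow> 'v) \<times> (nat \<Rightarrow> nat \<Rightarrow> 'u) \<times> (nat \<Rightarrow> nat \<Rightarrow> 'y)) measure" where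
  "static_law P Q \<gamma> =
     distr (primitive_law P \<Otimes>\<^sub>M (\<Pi>\<^sub>M i\<in>{1..num_agents P}. \<Pi>\<^sub>M t\<in>{..<horizon P}. Q i t)) (joint_space P)
       (\<lambda>((o0, x0, w, v), y).
          (o0, x0, w, v, hist P (horizon P) (closed_loop P \<gamma> (\<lambda>_. y) (horizon P)), y))"

definition static_density ::
  "('a, 'o, 'x, 'u, 'y, 'w, 'v) team
     \<Rightarrow> (nat \<Rightarrow> nat \<Rightarrow> 'y \<times> 'o \<times> 'x \<times> (nat \<Rightarrow> nat \<Rightarrow> 'v) \<times> (nat \<Rightarrow> nat \<Rightarrow> 'w) \<times> (nat \<Rightarrow> nat \<Rightarrow> 'y) \<times> (nat \<Rightarrow> nat \<Rightarrow> 'u)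
          \<Rightarrow> ennreal)
     \<Rightarrow> 'o \<times> 'x \<times> (nat \<Rightarrow> nat \<Rightarrow> 'w) \<times> (nat \<Rightarrow> nat \<Rightarrow> 'v) \<times> (nat \<Rightarrow> nat \<Rightarrow> 'u) \<times> (nat \<Rightarrow> nat \<Rightarrow> 'y) \<Rightarrow> ennreal" where
  "static_density P \<phi> = (\<lambda>(o0, x0, w, v, u, y).
     \<Prod>t<horizon P. \<Prod>i\<in>{1..num_agents P}.
       \<phi> i t (y i t, o0, x0, hist P t v, hist P t w, hist P t y, hist P t u))"

text \<open>
  The conditional law of the measurements at time \<open>t\<close>, under every admissible policy and with
  \<open>Q\<close> and \<open>\<phi>\<close> not depending on the policy.
\<close>

definition static_kernel_condition ::
  "('a, 'o, 'x, 'u, 'y, 'w, 'v) team \<Rightarrow> (nat \<Rightarrow> nat \<Rightarrow> 'y measure)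
     \<Rightarrow> (nat \<Rightarrow> nat \<Rightarrow> 'y \<times> 'o \<times> 'x \<times> (nat \<Rightarrow> nat \<Rightarrow> 'v) \<times> (nat \<Rightarrow> nat \<Rightarrow> 'w) \<times> (nat \<Rightarrow> nat \<Rightarrow> 'y) \<times> (nat \<Rightarrow> nat \<Rightarrow> 'u)
          \<Rightarrow> ennreal) \<Rightarrow> bool" where
  "static_kernel_condition P Q \<phi> \<longleftrightarrow>
     (\<forall>\<gamma>\<in>policies P. \<forall>t<horizon P. \<forall>A\<in>(\<Pi> i\<in>{1..num_agents P}. sets (obs_space P i t)).
        AE \<omega> in sample P.
          nn_cond_exp (sample P) (vimage_algebra (space (sample P)) (past P \<gamma> t) (past_space P t))
            (indicator {\<omega>\<in>space (sample P). \<forall>i\<in>{1..num_agents P}. Y_path P \<gamma> \<omega> i t \<in> A i}) \<omega>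
          = (\<Prod>i\<in>{1..num_agents P}. \<integral>\<^sup>+y\<in>A i. \<phi> i t (y, past P \<gamma> t \<omega>) \<partial>Q i t))"

text \<open>
  The change of measure from \<open>joint_law\<close> to \<open>static_law\<close> with density \<open>static_density\<close>, as an identity
  between the laws of \<open>(\<omega>0, x0, w, u, y)\<close>, which are the variables that determine the cost and the
  actions. It follows from the identity with \<open>v\<close> retained (lemma \<open>static_change_of_measureI\<close>).
  The latter would be too demanding: \<open>y i t\<close> is a function of the history and of \<open>v i t\<close>, but is
  independent of \<open>v\<close> under \<open>static_law\<close>, so that with \<open>v\<close> retained even additive Gaussian measurement
  noise makes the two laws singular to each other.

  The identity is part of the definition of the reduction because \<open>static_kernel_condition\<close> alone does
  not imply it for dependent disturbances. For instance, let \<open>N = T = 1\<close>, let \<open>\<omega>0\<close> and \<open>x0\<close> be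
  constant, \<open>y = v = w\<close> a fair coin, \<open>Q\<close> its law and \<open>\<phi> = 1\<close>. Under \<open>joint_law\<close> the action
  \<open>u = y\<close> matches \<open>w\<close>, whereas under \<open>static_law\<close> every action is independent of \<open>w\<close>.
\<close>

definition static_change_of_measure ::
  "('a, 'o, 'x, 'u, 'y, 'w, 'v) team \<Rightarrow> (nat \<Rightarrow> nat \<Rightarrow> 'y measure)
     \<Rightarrow> (nat \<Rightarrow> nat \<Rightarrow> 'y \<times> 'o \<times> 'x \<times> (nat \<Rightarrow> nat \<Rightarrow> 'v) \<times> (nat \<Rightarrow> nat \<Rightarrow> 'w) \<times> (nat \<Rightarrow> nat \<Rightarrow> 'y) \<times> (nat \<Rightarrow> nat \<Rightarrow> 'u)
          \<Rightarrow> ennreal) \<Rightarrow> bool" where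
  "static_change_of_measure P Q \<phi> \<longleftrightarrow>
     (let S = exo_space P \<Otimes>\<^sub>M state_space P 0 \<Otimes>\<^sub>M hist_space P (dist_space P) (horizon P) \<Otimes>\<^sub>M
              hist_space P (act_space P) (horizon P) \<Otimes>\<^sub>M hist_space P (obs_space P) (horizon P);
          drop_noise = (\<lambda>(o0, x0, w, v, u, y). (o0, x0, w, u, y))
      in \<forall>\<gamma>\<in>policies P.
           distr (joint_law P \<gamma>) S drop_noise =
           distr (density (static_law P Q \<gamma>) (static_density P \<phi>)) S drop_noise)"

lemma static_change_of_measureI:
  assumes "\<And>\<gamma>. \<gamma> \<in> policies P \<Longrightarrow> joint_law P \<gamma> = density (static_law P Q \<gamma>) (static_density P \<phi>)"
  shows "static_change_of_measure P Q \<phi>"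
  using assms by (simp add: static_change_of_measure_def)

definition independent_data_static_reduction ::
  "('a, 'o, 'x, 'u, 'y, 'w, 'v) team \<Rightarrow> (nat \<Rightarrow> nat \<Rightarrow> 'y measure)
     \<Rightarrow> (nat \<Rightarrow> nat \<Rightarrow> 'y \<times> 'o \<times> 'x \<times> (nat \<Rightarrow> nat \<Rightarrow> 'v) \<times> (nat \<Rightarrow> nat \<Rightarrow> 'w) \<times> (nat \<Rightarrow> nat \<Rightarrow> 'y) \<times> (nat \<Rightarrow> nat \<Rightarrow> 'u)
          \<Rightarrow> ennreal) \<Rightarrow> bool" where
  "independent_data_static_reduction P Q \<phi> \<longleftrightarrow>
     (\<forall>i\<in>{1..num_agents P}. \<forall>t<horizon P.
        prob_space (Q i t) \<and> sets (Q i t) = sets (obs_space P i t) \<and>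
        \<phi> i t \<in> borel_measurable (obs_space P i t \<Otimes>\<^sub>M past_space P t)) \<and>
     static_kernel_condition P Q \<phi> \<and>
     static_change_of_measure P Q \<phi>"

definition static_expected_cost ::
  "('a, 'o, 'x, 'u, 'y, 'w, 'v) team \<Rightarrow> (nat \<Rightarrow> nat \<Rightarrow> 'y measure)
     \<Rightarrow> (nat \<Rightarrow> nat \<Rightarrow> 'y \<times> 'o \<times> 'x \<times> (nat \<Rightarrow> nat \<Rightarrow> 'v) \<times> (nat \<Rightarrow> nat \<Rightarrow> 'w) \<times> (nat \<Rightarrow> nat \<Rightarrow> 'y) \<times> (nat \<Rightarrow> nat \<Rightarrow> 'u)
          \<Rightarrow> ennreal) \<Rightarrow> ('y, 'u) team_policy \<Rightarrow> ennreal" where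
  "static_expected_cost P Q \<phi> \<gamma> =
     (\<integral>\<^sup>+z. (case z of (o0, x0, w, v, u, y) \<Rightarrow> total_cost P o0 x0 w u) * static_density P \<phi> z
        \<partial>static_law P Q \<gamma>)"

section \<open>Agent-wise (partially) nested independent reduction\<close>

definition agent_space ::
  "('a, 'o, 'x, 'u, 'y, 'w, 'v) team \<Rightarrow> nat \<Rightarrow> ((nat \<Rightarrow> 'u) \<times> (nat \<Rightarrow> 'y) \<times> (nat \<Rightarrow> 'w)) measure" where
  "agent_space P i =
     (\<Pi>\<^sub>M t\<in>{..<horizon P}. act_space P i t) \<Otimes>\<^sub>M (\<Pi>\<^sub>M t\<in>{..<horizon P}. obs_space P i t) \<Otimes>\<^sub>M
     (\<Pi>\<^sub>M t\<in>{..<horizon P}. dist_space P i t)"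

definition agents_path ::
  "('a, 'o, 'x, 'u, 'y, 'w, 'v) team \<Rightarrow> ('y, 'u) team_policy \<Rightarrow> 'a
     \<Rightarrow> (nat \<Rightarrow> (nat \<Rightarrow> 'u) \<times> (nat \<Rightarrow> 'y) \<times> (nat \<Rightarrow> 'w)) \<times> 'o" where
  "agents_path P \<gamma> \<omega> =
     (\<lambda>i\<in>{1..num_agents P}. (U_path P \<gamma> \<omega> i, Y_path P \<gamma> \<omega> i, W_path P \<omega> i), exo P \<omega>)"

definition agents_law ::
  "('a, 'o, 'x, 'u, 'y, 'w, 'v) team \<Rightarrow> ('y, 'u) team_policy
     \<Rightarrow> ((nat \<Rightarrow> (nat \<Rightarrow> 'u) \<times> (nat \<Rightarrow> 'y) \<times> (nat \<Rightarrow> 'w)) \<times> 'o) measure" where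
  "agents_law P \<gamma> = distr (sample P)
     ((\<Pi>\<^sub>M i\<in>{1..num_agents P}. agent_space P i) \<Otimes>\<^sub>M exo_space P) (agents_path P \<gamma>)"

definition agents_product_law ::
  "('a, 'o, 'x, 'u, 'y, 'w, 'v) team
     \<Rightarrow> (('y, 'u) team_policy \<Rightarrow> nat \<Rightarrow> ((nat \<Rightarrow> 'u) \<times> (nat \<Rightarrow> 'y) \<times> (nat \<Rightarrow> 'w)) measure)
     \<Rightarrow> ('y, 'u) team_policy \<Rightarrow> ((nat \<Rightarrow> (nat \<Rightarrow> 'u) \<times> (nat \<Rightarrow> 'y) \<times> (nat \<Rightarrow> 'w)) \<times> 'o) measure" where
  "agents_product_law P Q \<gamma> =
     (\<Pi>\<^sub>M i\<in>{1..num_agents P}. Q \<gamma> i) \<Otimes>\<^sub>M distr (sample P) (exo_space P) (exo P)"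

text \<open>
  \<open>Q \<gamma> i\<close> is the law of the actions, observations and disturbances of agent \<open>i\<close>; it may depend on the
  policy, whereas the density \<open>\<rho>\<close> and the total cost \<open>c\<close> as a function of the listed variables do
  not. The requirement on \<open>c\<close> says that the initial state enters the cost only through \<open>\<omega>0\<close>, \<open>u\<close>,
  \<open>y\<close> and \<open>w\<close>.
\<close>

definition agent_independent_reduction ::
  "('a, 'o, 'x, 'u, 'y, 'w, 'v) team
     \<Rightarrow> (('y, 'u) team_policy \<Rightarrow> nat \<Rightarrow> ((nat \<Rightarrow> 'u) \<times> (nat \<Rightarrow> 'y) \<times> (nat \<Rightarrow> 'w)) measure)
     \<Rightarrow> ((nat \<Rightarrow> (nat \<Rightarrow> 'u) \<times> (nat \<Rightarrow> 'y) \<times> (nat \<Rightarrow> 'w)) \<times> 'o \<Rightarrow> ennreal)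
     \<Rightarrow> ((nat \<Rightarrow> (nat \<Rightarrow> 'u) \<times> (nat \<Rightarrow> 'y) \<times> (nat \<Rightarrow> 'w)) \<times> 'o \<Rightarrow> ennreal) \<Rightarrow> bool" where
  "agent_independent_reduction P Q \<rho> c \<longleftrightarrow>
     \<rho> \<in> borel_measurable ((\<Pi>\<^sub>M i\<in>{1..num_agents P}. agent_space P i) \<Otimes>\<^sub>M exo_space P) \<and>
     c \<in> borel_measurable ((\<Pi>\<^sub>M i\<in>{1..num_agents P}. agent_space P i) \<Otimes>\<^sub>M exo_space P) \<and>
     (\<forall>\<gamma>\<in>policies P.
        (\<forall>i\<in>{1..num_agents P}. prob_space (Q \<gamma> i) \<and> sets (Q \<gamma> i) = sets (agent_space P i)) \<and>
        agents_law P \<gamma> = density (agents_product_law P Q \<gamma>) \<rho> \<and>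
        (AE \<omega> in sample P.
           total_cost P (exo P \<omega>) (init P \<omega>) (W_path P \<omega>) (U_path P \<gamma> \<omega>) = c (agents_path P \<gamma> \<omega>)))"

text \<open>
  Inclusion of the sigma-algebra of \<open>y i s\<close> in that of \<open>y i t\<close> under the law \<open>R\<close> of agent \<open>i\<close>. It is
  taken up to null sets, since \<open>R\<close> is a law on a product space, on which distinct coordinates are
  functions of each other only almost everywhere.
\<close>

definition obs_sigma_subset ::
  "('a, 'o, 'x, 'u, 'y, 'w, 'v) team \<Rightarrow> nat \<Rightarrow> ((nat \<Rightarrow> 'u) \<times> (nat \<Rightarrow> 'y) \<times> (nat \<Rightarrow> 'w)) measure
     \<Rightarrow> nat \<Rightarrow> nat \<Rightarrow> bool" where
  "obs_sigma_subset P i R s t \<longleftrightarrow>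
     (\<forall>A\<in>sets (obs_space P i s). \<exists>B\<in>sets (obs_space P i t).
        AE (u, y, w) in R. y s \<in> A \<longleftrightarrow> y t \<in> B)"

definition nested_through_time ::
  "('a, 'o, 'x, 'u, 'y, 'w, 'v) team
     \<Rightarrow> (('y, 'u) team_policy \<Rightarrow> nat \<Rightarrow> ((nat \<Rightarrow> 'u) \<times> (nat \<Rightarrow> 'y) \<times> (nat \<Rightarrow> 'w)) measure) \<Rightarrow> bool" where
  "nested_through_time P Q \<longleftrightarrow>
     (\<forall>\<gamma>\<in>policies P. \<forall>i\<in>{1..num_agents P}. \<forall>t. Suc t < horizon P \<longrightarrow>
        obs_sigma_subset P i (Q \<gamma> i) t (Suc t))"

text \<open>
  Under the reduction, the decision at time \<open>s\<close> of agent \<open>i\<close> affects the agent's measurement at time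
  \<open>t\<close> if changing the policy \<open>\<gamma> i s\<close> alone can change the law of that measurement jointly with what is
  not influenced by the decision (the disturbances and the measurements up to time \<open>s\<close>).
  Partial nestedness requires the inclusion only in that case.
\<close>

definition affects_obs ::
  "('a, 'o, 'x, 'u, 'y, 'w, 'v) team
     \<Rightarrow> (('y, 'u) team_policy \<Rightarrow> nat \<Rightarrow> ((nat \<Rightarrow> 'u) \<times> (nat \<Rightarrow> 'y) \<times> (nat \<Rightarrow> 'w)) measure)
     \<Rightarrow> nat \<Rightarrow> nat \<Rightarrow> nat \<Rightarrow> bool" where
  "affects_obs P Q i s t \<longleftrightarrow>
     (let law = (\<lambda>\<gamma>. distr (Q \<gamma> i)
            ((\<Pi>\<^sub>M r\<in>{..s}. obs_space P i r) \<Otimes>\<^sub>M obs_space P i t \<Otimes>\<^sub>M (\<Pi>\<^sub>M r\<in>{..<horizon P}. dist_space P i r))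
            (\<lambda>(u, y, w). (restrict y {..s}, y t, w)))
      in \<exists>\<gamma>\<in>policies P. \<exists>\<beta>\<in>dm_policies P i s. law \<gamma> \<noteq> law (\<gamma>(i := (\<gamma> i)(s := \<beta>))))"

definition partially_nested_through_time ::
  "('a, 'o, 'x, 'u, 'y, 'w, 'v) team
     \<Rightarrow> (('y, 'u) team_policy \<Rightarrow> nat \<Rightarrow> ((nat \<Rightarrow> 'u) \<times> (nat \<Rightarrow> 'y) \<times> (nat \<Rightarrow> 'w)) measure) \<Rightarrow> bool" where
  "partially_nested_through_time P Q \<longleftrightarrow>
     (\<forall>\<gamma>\<in>policies P. \<forall>i\<in>{1..num_agents P}. \<forall>t<horizon P. \<forall>s<t.
        affects_obs P Q i s t \<longrightarrow> obs_sigma_subset P i (Q \<gamma> i) s t)"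

definition agent_nested_independent_reduction ::
  "('a, 'o, 'x, 'u, 'y, 'w, 'v) team
     \<Rightarrow> (('y, 'u) team_policy \<Rightarrow> nat \<Rightarrow> ((nat \<Rightarrow> 'u) \<times> (nat \<Rightarrow> 'y) \<times> (nat \<Rightarrow> 'w)) measure)
     \<Rightarrow> ((nat \<Rightarrow> (nat \<Rightarrow> 'u) \<times> (nat \<Rightarrow> 'y) \<times> (nat \<Rightarrow> 'w)) \<times> 'o \<Rightarrow> ennreal)
     \<Rightarrow> ((nat \<Rightarrow> (nat \<Rightarrow> 'u) \<times> (nat \<Rightarrow> 'y) \<times> (nat \<Rightarrow> 'w)) \<times> 'o \<Rightarrow> ennreal) \<Rightarrow> bool" where
  "agent_nested_independent_reduction P Q \<rho> c \<longleftrightarrow>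
     agent_independent_reduction P Q \<rho> c \<and> nested_through_time P Q"

definition agent_partially_nested_independent_reduction ::
  "('a, 'o, 'x, 'u, 'y, 'w, 'v) team
     \<Rightarrow> (('y, 'u) team_policy \<Rightarrow> nat \<Rightarrow> ((nat \<Rightarrow> 'u) \<times> (nat \<Rightarrow> 'y) \<times> (nat \<Rightarrow> 'w)) measure)
     \<Rightarrow> ((nat \<Rightarrow> (nat \<Rightarrow> 'u) \<times> (nat \<Rightarrow> 'y) \<times> (nat \<Rightarrow> 'w)) \<times> 'o \<Rightarrow> ennreal)
     \<Rightarrow> ((nat \<Rightarrow> (nat \<Rightarrow> 'u) \<times> (nat \<Rightarrow> 'y) \<times> (nat \<Rightarrow> 'w)) \<times> 'o \<Rightarrow> ennreal) \<Rightarrow> bool" where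
  "agent_partially_nested_independent_reduction P Q \<rho> c \<longleftrightarrow>
     agent_independent_reduction P Q \<rho> c \<and> partially_nested_through_time P Q"

definition agents_expected_cost ::
  "('a, 'o, 'x, 'u, 'y, 'w, 'v) team
     \<Rightarrow> (('y, 'u) team_policy \<Rightarrow> nat \<Rightarrow> ((nat \<Rightarrow> 'u) \<times> (nat \<Rightarrow> 'y) \<times> (nat \<Rightarrow> 'w)) measure)
     \<Rightarrow> ((nat \<Rightarrow> (nat \<Rightarrow> 'u) \<times> (nat \<Rightarrow> 'y) \<times> (nat \<Rightarrow> 'w)) \<times> 'o \<Rightarrow> ennreal)
     \<Rightarrow> ((nat \<Rightarrow> (nat \<Rightarrow> 'u) \<times> (nat \<Rightarrow> 'y) \<times> (nat \<Rightarrow> 'w)) \<times> 'o \<Rightarrow> ennreal)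
     \<Rightarrow> ('y, 'u) team_policy \<Rightarrow> ennreal" where
  "agents_expected_cost P Q \<rho> c \<gamma> = (\<integral>\<^sup>+z. c z * \<rho> z \<partial>agents_product_law P Q \<gamma>)"

end

theory Submission
  imports Defs
begin

text \<open>
  Both reductions are changes of measure whose density does not depend on the policy, so the expected
  cost of the reduced problem agrees with the original one at every admissible policy, not only at
  \<open>\<gamma>\<close>. As unilateral deviations of admissible policies are admissible, the pbp optimality
  conditions of the two problems compare the same numbers. What has to be checked is that the
  closed-loop trajectories, the cost and the density are measurable, so that the image measures
  carry the expected costs.
\<close>

section \<open>Costs that agree on admissible policies\<close>

lemma policies_update_agent:
  assumes "\<gamma> \<in> policies P" "\<beta> \<in> agent_policies P i"
  shows "\<gamma>(i := \<beta>) \<in> policies P"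
  using assms by (auto simp: policies_def)

text \<open>A deviation of one decision maker is a deviation of its whole agent: the range of
  \<open>i\<close> makes \<open>\<gamma> i\<close> admissible at the times other than
  \<open>t\<close>.\<close>

lemma policies_update_dm:
  assumes "\<gamma> \<in> policies P" "i \<in> {1..num_agents P}" "\<beta> \<in> dm_policies P i t"
  shows "\<gamma>(i := (\<gamma> i)(t := \<beta>)) \<in> policies P"
  using assms by (intro policies_update_agent) (auto simp: policies_def agent_policies_def)

text \<open>The costs are compared only at \<open>\<gamma>\<close> and at its unilateral deviations,
  all admissible. For inadmissible \<open>\<gamma>\<close> both sides are false, since optimality
  includes membership in \<open>policies P\<close>.\<close>

lemma agent_pbp_optimal_cong:
  assumes "\<And>\<gamma>. \<gamma> \<in> policies P \<Longrightarrow> K \<gamma> = K' \<gamma>"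
  shows "agent_pbp_optimal P K \<gamma> \<longleftrightarrow> agent_pbp_optimal P K' \<gamma>"
  by (auto simp: agent_pbp_optimal_def assms policies_update_agent)

lemma dm_pbp_optimal_cong:
  assumes "\<And>\<gamma>. \<gamma> \<in> policies P \<Longrightarrow> K \<gamma> = K' \<gamma>"
  shows "dm_pbp_optimal P K \<gamma> \<longleftrightarrow> dm_pbp_optimal P K' \<gamma>"
  by (auto simp: dm_pbp_optimal_def assms policies_update_dm)

section \<open>Measurability of trajectories\<close>

lemma measurable_hist:
  assumes "\<And>i s. i \<in> {1..num_agents P} \<Longrightarrow> s < n \<Longrightarrow> (\<lambda>z. f z i s) \<in> M \<rightarrow>\<^sub>M Z i s"
  shows "(\<lambda>z. hist P n (f z)) \<in> M \<rightarrow>\<^sub>M hist_space P Z n"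
  unfolding hist_def hist_space_def using assms by (intro measurable_restrict) auto

lemma measurable_hist_component:
  assumes "f \<in> M \<rightarrow>\<^sub>M hist_space P Z n" "i \<in> {1..num_agents P}" "s < n"
  shows "(\<lambda>z. f z i s) \<in> M \<rightarrow>\<^sub>M Z i s"
proof -
  have "(\<lambda>h. h i) \<in> hist_space P Z n \<rightarrow>\<^sub>M (\<Pi>\<^sub>M s\<in>{..<n}. Z i s)"
    unfolding hist_space_def using assms(2) by (rule measurable_component_singleton)
  moreover have "(\<lambda>h. h s) \<in> (\<Pi>\<^sub>M s\<in>{..<n}. Z i s) \<rightarrow>\<^sub>M Z i s"
    using assms(3) by (intro measurable_component_singleton) auto
  ultimately have "(\<lambda>h. h i s) \<in> hist_space P Z n \<rightarrow>\<^sub>M Z i s"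
    by (rule measurable_compose)
  from measurable_compose[OF assms(1) this] show ?thesis .
qed

text \<open>Serves the density, whose factor at time \<open>t\<close> sees full trajectories cut off
  before \<open>t\<close>.\<close>

lemma measurable_hist_le:
  assumes "f \<in> M \<rightarrow>\<^sub>M hist_space P Z n" "m \<le> n"
  shows "(\<lambda>z. hist P m (f z)) \<in> M \<rightarrow>\<^sub>M hist_space P Z m"
  using assms by (intro measurable_hist measurable_hist_component[OF assms(1)]) auto

context dynamic_team
begin

text \<open>Induction along the dynamics. Disturbances and actions are constrained only before
  \<open>t\<close>, so the lemma applies inside the closed loop, where later actions have not been
  generated yet.\<close>

lemma measurable_states:
  assumes "t \<le> horizon P"
    and "x0 \<in> M \<rightarrow>\<^sub>M state_space P 0"
    and "\<And>i s. i \<in> {1..num_agents P} \<Longrightarrow> s < t \<Longrightarrow> (\<lambda>z. w z i s) \<in> M \<rightarrow>\<^sub>M dist_space P i s"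
    and "\<And>i s. i \<in> {1..num_agents P} \<Longrightarrow> s < t \<Longrightarrow> (\<lambda>z. u z i s) \<in> M \<rightarrow>\<^sub>M act_space P i s"
  shows "(\<lambda>z. states P (x0 z) (w z) (u z) t) \<in> M \<rightarrow>\<^sub>M (\<Pi>\<^sub>M s\<in>{..t}. state_space P s)"
  using assms
proof (induction t)
  case 0
  then show ?case unfolding states.simps by (intro measurable_restrict) auto
next
  case (Suc t)
  have states: "(\<lambda>z. states P (x0 z) (w z) (u z) t) \<in> M \<rightarrow>\<^sub>M (\<Pi>\<^sub>M s\<in>{..t}. state_space P s)"
    using Suc by auto
  \<comment> \<open>The state at \<open>Suc t\<close> depends on actions up to and including time
    \<open>t\<close>, hence the history length \<open>Suc t\<close>; an observation at time
    \<open>t\<close> sees only length \<open>t\<close>.\<close>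
  have "(\<lambda>z. (states P (x0 z) (w z) (u z) t, hist P (Suc t) (u z), \<lambda>i\<in>{1..num_agents P}. w z i t))
      \<in> M \<rightarrow>\<^sub>M (\<Pi>\<^sub>M s\<in>{..t}. state_space P s) \<Otimes>\<^sub>M hist_space P (act_space P) (Suc t)
         \<Otimes>\<^sub>M (\<Pi>\<^sub>M i\<in>{1..num_agents P}. dist_space P i t)"
    using Suc.prems by (intro measurable_Pair states measurable_hist measurable_restrict) auto
  from measurable_compose[OF this dyn_meas] Suc.prems(1)
  have "(\<lambda>z. dyn P t (states P (x0 z) (w z) (u z) t, hist P (Suc t) (u z),
      \<lambda>i\<in>{1..num_agents P}. w z i t)) \<in> M \<rightarrow>\<^sub>M state_space P (Suc t)"
    by simp
  then show ?case
    unfolding states.simps by (intro measurable_fun_upd[OF _ states]) auto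
qed

lemma measurable_observations:
  assumes "i \<in> {1..num_agents P}" "t < horizon P"
    and "x0 \<in> M \<rightarrow>\<^sub>M state_space P 0"
    and "w \<in> M \<rightarrow>\<^sub>M hist_space P (dist_space P) (horizon P)"
    and "v \<in> M \<rightarrow>\<^sub>M hist_space P (noise_space P) (horizon P)"
    and u: "\<And>i s. i \<in> {1..num_agents P} \<Longrightarrow> s < t \<Longrightarrow> (\<lambda>z. u z i s) \<in> M \<rightarrow>\<^sub>M act_space P i s"
  shows "(\<lambda>z. observations P (x0 z) (w z) (v z) (u z) i t) \<in> M \<rightarrow>\<^sub>M obs_space P i t"
  unfolding observations_def
  by (rule measurable_compose[OF _ obs_map_meas[OF assms(1,2)]])
     (use assms in \<open>intro measurable_Pair measurable_states measurable_hist u,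
       auto intro: measurable_hist_component\<close>)

text \<open>Causality breaks the circle between actions and observations. The premise on
  \<open>G\<close> asks that the observation at time \<open>t\<close> be measurable as soon as the
  actions before \<open>t\<close> are, for any action process; induction on time then generates one
  measurable action after the other.\<close>

lemma measurable_closed_loop:
  assumes \<gamma>: "\<gamma> \<in> policies P"
    and G: "\<And>u t j. t < horizon P \<Longrightarrow> j \<in> {1..num_agents P} \<Longrightarrow>
      (\<And>i s. i \<in> {1..num_agents P} \<Longrightarrow> s < t \<Longrightarrow> (\<lambda>z. u z i s) \<in> M \<rightarrow>\<^sub>M act_space P i s) \<Longrightarrow>
      (\<lambda>z. G z (u z) j t) \<in> M \<rightarrow>\<^sub>M obs_space P j t"
    and "t \<le> horizon P" "i \<in> {1..num_agents P}" "s < t"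
  shows "(\<lambda>z. closed_loop P \<gamma> (G z) t i s) \<in> M \<rightarrow>\<^sub>M act_space P i s"
  using assms(3-)
proof (induction t arbitrary: i s)
  case 0
  then show ?case by simp
next
  case (Suc t)
  show ?case
  proof (cases "s = t")
    case True
    have t: "t < horizon P" using Suc.prems by simp
    \<comment> \<open>An observation at time \<open>r \<le> t\<close> needs only actions before
      \<open>r\<close>, and these are covered by the induction hypothesis.\<close>
    have "(\<lambda>z. G z (closed_loop P \<gamma> (G z) t) j r) \<in> M \<rightarrow>\<^sub>M obs_space P j r"
      if "j \<in> {1..num_agents P}" "r \<le> t" for j r
      using that t Suc.IH by (intro G) auto
    moreover have "(\<lambda>z. closed_loop P \<gamma> (G z) t j r) \<in> M \<rightarrow>\<^sub>M act_space P j r"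
      if "j \<in> {1..num_agents P}" "r < t" for j r
      using that t Suc.IH by auto
    \<comment> \<open>The information contains observations up to time \<open>t\<close> and actions
      strictly before \<open>t\<close>, which is exactly what has been shown measurable.\<close>
    ultimately have "(\<lambda>z. info P i t (G z (closed_loop P \<gamma> (G z) t)) (closed_loop P \<gamma> (G z) t))
        \<in> M \<rightarrow>\<^sub>M info_space P i t"
      unfolding info_def info_space_def
      using obs_info_sub[OF Suc.prems(2) t] act_info_sub[OF Suc.prems(2) t]
      by (intro measurable_Pair measurable_restrict) auto
    moreover have "\<gamma> i t \<in> info_space P i t \<rightarrow>\<^sub>M act_space P i t"
      using \<gamma> Suc.prems(2) t by (auto simp: policies_def agent_policies_def dm_policies_def)
    ultimately show ?thesis
      using True by (auto intro: measurable_compose)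
  next
    case False
    then show ?thesis using Suc by simp
  qed
qed

lemma measurable_W_path: "W_path P \<in> sample P \<rightarrow>\<^sub>M hist_space P (dist_space P) (horizon P)"
  unfolding W_path_def[abs_def] by (intro measurable_hist dist_meas)

lemma measurable_V_path: "V_path P \<in> sample P \<rightarrow>\<^sub>M hist_space P (noise_space P) (horizon P)"
  unfolding V_path_def[abs_def] by (intro measurable_hist noise_meas)

lemma measurable_U_path:
  assumes "\<gamma> \<in> policies P"
  shows "U_path P \<gamma> \<in> sample P \<rightarrow>\<^sub>M hist_space P (act_space P) (horizon P)"
  unfolding U_path_def[abs_def]
  by (intro measurable_hist measurable_closed_loop measurable_observations assms
      init_meas measurable_W_path measurable_V_path order_refl) auto

lemma measurable_Y_path:
  assumes "\<gamma> \<in> policies P"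
  shows "Y_path P \<gamma> \<in> sample P \<rightarrow>\<^sub>M hist_space P (obs_space P) (horizon P)"
  unfolding Y_path_def[abs_def]
  by (intro measurable_hist measurable_observations
      init_meas measurable_W_path measurable_V_path)
     (auto intro: measurable_hist_component[OF measurable_U_path[OF assms]])

lemma measurable_total_cost:
  assumes "o0 \<in> M \<rightarrow>\<^sub>M exo_space P" "x0 \<in> M \<rightarrow>\<^sub>M state_space P 0"
    and w: "w \<in> M \<rightarrow>\<^sub>M hist_space P (dist_space P) (horizon P)"
    and u: "u \<in> M \<rightarrow>\<^sub>M hist_space P (act_space P) (horizon P)"
  shows "(\<lambda>z. total_cost P (o0 z) (x0 z) (w z) (u z)) \<in> borel_measurable M"
proof -
  \<comment> \<open>The endpoint \<open>t = horizon P\<close> is included for the final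
    cost.\<close>
  have state: "(\<lambda>z. states P (x0 z) (w z) (u z) t t) \<in> M \<rightarrow>\<^sub>M state_space P t"
    if "t \<le> horizon P" for t
  proof -
    have "(\<lambda>z. states P (x0 z) (w z) (u z) t) \<in> M \<rightarrow>\<^sub>M (\<Pi>\<^sub>M s\<in>{..t}. state_space P s)"
      using that assms
      by (intro measurable_states) (auto intro: measurable_hist_component[OF w] measurable_hist_component[OF u])
    from measurable_compose[OF this measurable_component_singleton] show ?thesis by simp
  qed
  have "(\<lambda>z. stage_cost P t (o0 z, states P (x0 z) (w z) (u z) t t, \<lambda>i\<in>{1..num_agents P}. u z i t))
      \<in> borel_measurable M" if "t < horizon P" for t
    by (rule measurable_compose[OF _ stage_cost_meas[OF that]])
       (use that assms(1) in \<open>intro measurable_Pair measurable_restrict state measurable_hist_component[OF u], auto\<close>)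
  moreover have "(\<lambda>z. final_cost P (states P (x0 z) (w z) (u z) (horizon P) (horizon P)))
      \<in> borel_measurable M"
    using measurable_compose[OF state final_cost_meas] by simp
  ultimately show ?thesis
    unfolding total_cost_def
    by (intro measurable_compose[OF _ measurable_ennreal] borel_measurable_add borel_measurable_sum) auto
qed

section \<open>Independent-data static reduction\<close>

lemma measurable_static_density:
  assumes "\<And>i t. i \<in> {1..num_agents P} \<Longrightarrow> t < horizon P \<Longrightarrow>
      \<phi> i t \<in> borel_measurable (obs_space P i t \<Otimes>\<^sub>M past_space P t)"
  shows "static_density P \<phi> \<in> borel_measurable (joint_space P)"
proof -
  \<comment> \<open>Each factor is \<open>\<phi> i t\<close> composed with a map that truncates the
    histories and reorders them: \<open>joint_space\<close> lists \<open>w, v, u, y\<close>, whereas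
    \<open>past_space\<close> lists \<open>v, w, y, u\<close>.\<close>
  have "(\<lambda>z. case z of (o0, x0, w, v, u, y) \<Rightarrow>
        \<phi> i t (y i t, o0, x0, hist P t v, hist P t w, hist P t y, hist P t u))
      \<in> borel_measurable (joint_space P)"
    if it: "i \<in> {1..num_agents P}" "t < horizon P" for i t
    unfolding split_beta'
    by (rule measurable_compose[OF _ assms[OF it]])
       (use it in \<open>unfold past_space_def joint_space_def,
         intro measurable_Pair measurable_hist_le[where n = "horizon P"]
           measurable_hist_component[where n = "horizon P" and Z = "obs_space P"], auto\<close>)
  then show ?thesis
    unfolding static_density_def split_beta'
    by (intro borel_measurable_prod_ennreal) auto
qed

text \<open>The total cost does not involve the measurement noise, so it factors through
  \<open>drop_noise\<close>, and the equality of the two laws without noise suffices to transfer its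
  integral.\<close>

lemma static_expected_cost_eq:
  assumes red: "independent_data_static_reduction P Q \<phi>" and \<gamma>: "\<gamma> \<in> policies P"
  shows "expected_cost P \<gamma> = static_expected_cost P Q \<phi> \<gamma>"
proof -
  define S where "S = exo_space P \<Otimes>\<^sub>M state_space P 0 \<Otimes>\<^sub>M
    hist_space P (dist_space P) (horizon P) \<Otimes>\<^sub>M hist_space P (act_space P) (horizon P) \<Otimes>\<^sub>M
    hist_space P (obs_space P) (horizon P)"
  define drop_noise :: "'o \<times> 'x \<times> (nat \<Rightarrow> nat \<Rightarrow> 'w) \<times> (nat \<Rightarrow> nat \<Rightarrow> 'v) \<times> (nat \<Rightarrow> nat \<Rightarrow> 'u)
      \<times> (nat \<Rightarrow> nat \<Rightarrow> 'y) \<Rightarrow> _"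
    where "drop_noise = (\<lambda>(o0, x0, w, v, u, y). (o0, x0, w, u, y))"
  define C :: "'o \<times> 'x \<times> (nat \<Rightarrow> nat \<Rightarrow> 'w) \<times> (nat \<Rightarrow> nat \<Rightarrow> 'u) \<times> (nat \<Rightarrow> nat \<Rightarrow> 'y) \<Rightarrow> ennreal"
    where "C = (\<lambda>(o0, x0, w, u, y). total_cost P o0 x0 w u)"
  have change: "distr (joint_law P \<gamma>) S drop_noise
      = distr (density (static_law P Q \<gamma>) (static_density P \<phi>)) S drop_noise"
    using red \<gamma> unfolding independent_data_static_reduction_def static_change_of_measure_def
      S_def drop_noise_def by (simp add: Let_def)
  have drop: "drop_noise \<in> joint_space P \<rightarrow>\<^sub>M S"
    unfolding drop_noise_def joint_space_def S_def split_beta' by measurable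
  have C: "C \<in> borel_measurable S"
    unfolding C_def S_def split_beta' by (intro measurable_total_cost) auto
  have dens: "static_density P \<phi> \<in> borel_measurable (joint_space P)"
    using red by (intro measurable_static_density) (auto simp: independent_data_static_reduction_def)
  have path: "(\<lambda>\<omega>. (exo P \<omega>, init P \<omega>, W_path P \<omega>, V_path P \<omega>, U_path P \<gamma> \<omega>, Y_path P \<gamma> \<omega>))
      \<in> sample P \<rightarrow>\<^sub>M joint_space P"
    unfolding joint_space_def
    by (intro measurable_Pair exo_meas init_meas measurable_W_path measurable_V_path
        measurable_U_path measurable_Y_path \<gamma>)
  have sets: "sets (joint_law P \<gamma>) = sets (joint_space P)"
    "sets (static_law P Q \<gamma>) = sets (joint_space P)"
    by (simp_all add: joint_law_def static_law_def)
  have C_drop: "(\<lambda>z. C (drop_noise z)) \<in> borel_measurable (joint_space P)"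
    by (rule measurable_compose[OF drop C])
  have "expected_cost P \<gamma> = (\<integral>\<^sup>+z. C (drop_noise z) \<partial>joint_law P \<gamma>)"
    unfolding joint_law_def expected_cost_def
    using path C_drop by (subst nn_integral_distr) (auto simp: C_def drop_noise_def)
  also have "\<dots> = (\<integral>\<^sup>+z. C z \<partial>distr (joint_law P \<gamma>) S drop_noise)"
    using drop C by (subst nn_integral_distr) (auto cong: measurable_cong_sets simp: sets)
  also have "\<dots> = (\<integral>\<^sup>+z. C z \<partial>distr (density (static_law P Q \<gamma>) (static_density P \<phi>)) S drop_noise)"
    by (simp only: change)
  \<comment> \<open>The image under \<open>drop_noise\<close> is undone before the density is pulled
    out, because \<open>static_density\<close> may depend on the noise and so need not be a function
    on \<open>S\<close>.\<close>
  also have "\<dots> = (\<integral>\<^sup>+z. C (drop_noise z) \<partial>density (static_law P Q \<gamma>) (static_density P \<phi>))"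
    using drop C by (subst nn_integral_distr) (auto cong: measurable_cong_sets simp: sets)
  also have "\<dots> = (\<integral>\<^sup>+z. static_density P \<phi> z * C (drop_noise z) \<partial>static_law P Q \<gamma>)"
    using dens C_drop by (intro nn_integral_density) (auto cong: measurable_cong_sets simp: sets)
  also have "\<dots> = static_expected_cost P Q \<phi> \<gamma>"
    unfolding static_expected_cost_def C_def drop_noise_def
    by (intro nn_integral_cong) (auto simp: mult.commute)
  finally show ?thesis .
qed

section \<open>Agent-wise independent reduction\<close>

text \<open>Almost surely the cost is the fixed function \<open>c\<close> of the agents'
  trajectories and the exogenous variable, so its expectation is an integral over
  \<open>agents_law\<close>, where the change of measure to the product law applies.\<close>

lemma agents_expected_cost_eq:
  assumes red: "agent_independent_reduction P Q \<rho> c" and \<gamma>: "\<gamma> \<in> policies P"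
  shows "expected_cost P \<gamma> = agents_expected_cost P Q \<rho> c \<gamma>"
proof -
  let ?S = "(\<Pi>\<^sub>M i\<in>{1..num_agents P}. agent_space P i) \<Otimes>\<^sub>M exo_space P"
  have meas: "\<rho> \<in> borel_measurable ?S" "c \<in> borel_measurable ?S"
    and Q: "\<And>i. i \<in> {1..num_agents P} \<Longrightarrow> sets (Q \<gamma> i) = sets (agent_space P i)"
    and law: "agents_law P \<gamma> = density (agents_product_law P Q \<gamma>) \<rho>"
    and cost: "AE \<omega> in sample P. total_cost P (exo P \<omega>) (init P \<omega>) (W_path P \<omega>) (U_path P \<gamma> \<omega>)
        = c (agents_path P \<gamma> \<omega>)"
    using red \<gamma> by (auto simp: agent_independent_reduction_def)
  \<comment> \<open>\<open>agents_path\<close> regroups the trajectories by agent, so whole rows of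
    a history have to be measurable, not just single entries.\<close>
  have component: "(\<lambda>\<omega>. f \<omega> i) \<in> sample P \<rightarrow>\<^sub>M (\<Pi>\<^sub>M t\<in>{..<horizon P}. Z i t)"
    if "f \<in> sample P \<rightarrow>\<^sub>M hist_space P Z (horizon P)" "i \<in> {1..num_agents P}"
    for f :: "'a \<Rightarrow> nat \<Rightarrow> nat \<Rightarrow> 'z" and Z i
    using that unfolding hist_space_def
    by (rule measurable_compose[OF _ measurable_component_singleton])
  have path: "agents_path P \<gamma> \<in> sample P \<rightarrow>\<^sub>M ?S"
    unfolding agents_path_def[abs_def] agent_space_def
    by (intro measurable_Pair measurable_restrict exo_meas component measurable_U_path
        measurable_Y_path measurable_W_path \<gamma>)
  \<comment> \<open>Lets measurability of \<open>\<rho>\<close> and \<open>c\<close> pass to the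
    product law, whose factors \<open>Q \<gamma> i\<close> share only their measurable sets with
    \<open>agent_space P i\<close>.\<close>
  have sets: "sets (agents_product_law P Q \<gamma>) = sets ?S"
    unfolding agents_product_law_def using Q
    by (intro sets_pair_measure_cong sets_PiM_cong) auto
  have "expected_cost P \<gamma> = (\<integral>\<^sup>+\<omega>. c (agents_path P \<gamma> \<omega>) \<partial>sample P)"
    unfolding expected_cost_def by (intro nn_integral_cong_AE cost)
  also have "\<dots> = (\<integral>\<^sup>+z. c z \<partial>agents_law P \<gamma>)"
    unfolding agents_law_def using path meas by (simp add: nn_integral_distr)
  also have "\<dots> = (\<integral>\<^sup>+z. \<rho> z * c z \<partial>agents_product_law P Q \<gamma>)"
    unfolding law using meas
    by (intro nn_integral_density) (auto cong: measurable_cong_sets simp: sets)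
  also have "\<dots> = agents_expected_cost P Q \<rho> c \<gamma>"
    by (simp add: agents_expected_cost_def mult.commute)
  finally show ?thesis .
qed

end

theorem corollary6p1:
  fixes P :: "('a, 'o, 'x, 'u, 'y, 'w, 'v) team"
    and \<gamma> :: "('y, 'u) team_policy"
  assumes "dynamic_team P"
  shows
    "(\<forall>Q \<phi>. independent_data_static_reduction P Q \<phi> \<longrightarrow>
        (agent_pbp_optimal P (expected_cost P) \<gamma> \<longleftrightarrow> agent_pbp_optimal P (static_expected_cost P Q \<phi>) \<gamma>) \<and>
        (dm_pbp_optimal P (expected_cost P) \<gamma> \<longleftrightarrow> dm_pbp_optimal P (static_expected_cost P Q \<phi>) \<gamma>)) \<and>
     (\<forall>Q \<rho> c. agent_nested_independent_reduction P Q \<rho> c \<or>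
              agent_partially_nested_independent_reduction P Q \<rho> c \<longrightarrow>
        (agent_pbp_optimal P (expected_cost P) \<gamma> \<longleftrightarrow> agent_pbp_optimal P (agents_expected_cost P Q \<rho> c) \<gamma>))"
proof (intro conjI allI impI)
  interpret dynamic_team P by fact
  fix Q \<phi> assume red: "independent_data_static_reduction P Q \<phi>"
  show "agent_pbp_optimal P (expected_cost P) \<gamma> \<longleftrightarrow> agent_pbp_optimal P (static_expected_cost P Q \<phi>) \<gamma>"
    by (intro agent_pbp_optimal_cong static_expected_cost_eq red)
  show "dm_pbp_optimal P (expected_cost P) \<gamma> \<longleftrightarrow> dm_pbp_optimal P (static_expected_cost P Q \<phi>) \<gamma>"
    by (intro dm_pbp_optimal_cong static_expected_cost_eq red)
next
  interpret dynamic_team P by fact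
  fix Q \<rho> c
  assume "agent_nested_independent_reduction P Q \<rho> c \<or>
    agent_partially_nested_independent_reduction P Q \<rho> c"
  \<comment> \<open>Both versions contain the same change of measure, from which the cost identity
    follows.\<close>
  then have "agent_independent_reduction P Q \<rho> c"
    by (auto simp: agent_nested_independent_reduction_def
        agent_partially_nested_independent_reduction_def)
  then show "agent_pbp_optimal P (expected_cost P) \<gamma> \<longleftrightarrow> agent_pbp_optimal P (agents_expected_cost P Q \<rho> c) \<gamma>"
    by (intro agent_pbp_optimal_cong agents_expected_cost_eq)
qed

end
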